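(* The following continuous-time dynamics are recovered as contact Hamiltonian systems on $\mathbb R^{2n+1}$. (i) If $\mathcal H=H(X,P,t)$ does not depend explicitly on $S$, then in the std1 contact Hamiltonian system of $\mathcal H$ the equations for $(X,P)$ are the standard Hamiltonian equations $\dot X=\nabla_P H(X,P,t)$, $\dot P=-\nabla_X H(X,P,t)$, and the equation for $S$ is decoupled from them. In particular this includes, as a special case of contact Hamiltonian systems, the Bregman dynamics, i.e. the case $H=H_{\mathrm{Br}}$. (ii) If $\mathcal H=H(X,P)+c\,S$ with $c\in\mathbb R$ constant, then in the std1 contact Hamiltonian system of $\mathcal H$ the equations for $(X,P)$ are the conformally symplectic equations $\dot X=\nabla_P H(X,P)$, $\dot P=-\nabla_X H(X,P)-c\,P$, and the equation for $S$ is decoupled from them. (iii) If $\mathcal H=H(X,P)+\langle X^{*},P\rangle-\langle P^{*},X\rangle+2S$, where $(X^*,P^* )=\operatorname{argmin}H(X,P)$, then in the std2 contact Hamiltonian system of $\mathcal H$ the equations for $(X,P)$ are the Hamiltonian descent equations $\dot X=\nabla_P H(X,P)+X^{*}-X$, $\dot P=-\nabla_X H(X,P)+P^{*}-P$, and the equation for $S$ is decoupled from them. (iv) If $\mathcal H=\frac12\|P\|^{2}+f(X)+\frac{3}{t}S$ with $t>0$, then from the equations for $(X,P)$ in the std1 contact Hamiltonian system of $\mathcal H$ one obtains the continuous limit of Nesterov's accelerated gradient, $\ddot X+\frac{3}{t}\dot X+\nabla f(X)=0$, and the equation for $S$ is decoupled from them.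
   Context: Coordinates on $\mathbb R^{2n+1}$ are $(X,P,S)$ with $X,P\in\mathbb R^n$, $S\in\mathbb R$; $H$ and $f$ are differentiable. The std1 contact Hamiltonian system of a (possibly time-dependent) differentiable function $\mathcal H(X,P,S,t)$, associated with the contact form $\eta_{\mathrm{std1}}=dS-P\,dX$, is $$\dot X=\nabla_P\mathcal H,\qquad \dot P=-\nabla_X\mathcal H-P\frac{\partial\mathcal H}{\partial S},\qquad \dot S=\langle\nabla_P\mathcal H,P\rangle-\mathcal H.$$ The std2 contact Hamiltonian system of $\mathcal H$, associated with the contact form $\eta_{\mathrm{std2}}=dS-\frac12P\,dX+\frac12X\,dP$, is $$\dot X=\nabla_P\mathcal H-\tfrac12X\frac{\partial\mathcal H}{\partial S},\qquad \dot P=-\nabla_X\mathcal H-\tfrac12P\frac{\partial\mathcal H}{\partial S},\qquad \dot S=\tfrac12\big(\langle X,\nabla_X\mathcal H\rangle+\langle P,\nabla_P\mathcal H\rangle\big)-\mathcal H.$$ "The equation for $S$ is decoupled" means that the equations for $X$ and $P$ do not involve $S$. The Bregman Hamiltonian is $H_{\mathrm{Br}}(X,P,t)=e^{\alpha+\gamma}\big(D_{h^*}(e^{-\gamma}P+\nabla h(X),\nabla h(X))+e^{\beta}f(X)\big)$, where $\alpha,\beta,\gamma$ are continuously differentiable functions of $t$, $h$ is a convex distance-generating function, $h^*(P)=\sup_V(\langle P,V\rangle-h(V))$ is its Legendre transform, and $D_g(Y,X)=g(Y)-g(X)-\langle\nabla g(X),Y-X\rangle$. The Bregman dynamics is $\dot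 X=\nabla_P H_{\mathrm{Br}}$, $\dot P=-\nabla_X H_{\mathrm{Br}}$ (on the domain where $H_{\mathrm{Br}}$ is defined and differentiable). *)

theory Defs
  imports "HOL-Analysis.Analysis"
begin

text \<open>The gradient, as a function; meaningful only at points of differentiability.\<close>

definition grad :: "('a::real_inner \<Rightarrow> real) \<Rightarrow> 'a \<Rightarrow> 'a" where
  "grad g x = (THE D. GDERIV g x :> D)"

text \<open>A contact system is identified with the right-hand side of its differential equations: a map
  sending \<open>X P S t\<close> to the triple of prescribed velocities of \<open>X\<close>, \<open>P\<close> and \<open>S\<close>. A contact Hamiltonian
  takes its arguments in the same order \<open>X P S t\<close>.\<close>

definition std1_system ::
  "('a::real_inner \<Rightarrow> 'a \<Rightarrow> real \<Rightarrow> real \<Rightarrow> real) \<Rightarrow> 'a \<Rightarrow> 'a \<Rightarrow> real \<Rightarrow> real \<Rightarrow> 'a \<times> 'a \<times> real" where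
  "std1_system H X P S t =
     (let H_X = grad (\<lambda>X'. H X' P S t) X;
          H_P = grad (\<lambda>P'. H X P' S t) P;
          H_S = deriv (\<lambda>S'. H X P S' t) S
      in (H_P, - H_X - H_S *\<^sub>R P, inner H_P P - H X P S t))"

definition std2_system ::
  "('a::real_inner \<Rightarrow> 'a \<Rightarrow> real \<Rightarrow> real \<Rightarrow> real) \<Rightarrow> 'a \<Rightarrow> 'a \<Rightarrow> real \<Rightarrow> real \<Rightarrow> 'a \<times> 'a \<times> real" where
  "std2_system H X P S t =
     (let H_X = grad (\<lambda>X'. H X' P S t) X;
          H_P = grad (\<lambda>P'. H X P' S t) P;
          H_S = deriv (\<lambda>S'. H X P S' t) S
      in (H_P - (1/2 * H_S) *\<^sub>R X,
          - H_X - (1/2 * H_S) *\<^sub>R P,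
          1/2 * (inner X H_X + inner P H_P) - H X P S t))"

definition X_rhs :: "('a \<Rightarrow> 'a \<Rightarrow> real \<Rightarrow> real \<Rightarrow> 'a \<times> 'a \<times> real) \<Rightarrow> 'a \<Rightarrow> 'a \<Rightarrow> real \<Rightarrow> real \<Rightarrow> 'a" where
  "X_rhs F X P S t = fst (F X P S t)"

definition P_rhs :: "('a \<Rightarrow> 'a \<Rightarrow> real \<Rightarrow> real \<Rightarrow> 'a \<times> 'a \<times> real) \<Rightarrow> 'a \<Rightarrow> 'a \<Rightarrow> real \<Rightarrow> real \<Rightarrow> 'a" where
  "P_rhs F X P S t = fst (snd (F X P S t))"

text \<open>The set \<open>\<Omega>\<close> is the domain of definition in the variables \<open>(X, P, t)\<close>.\<close>

definition S_decoupled ::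
  "('a \<times> 'a \<times> real) set \<Rightarrow> ('a \<Rightarrow> 'a \<Rightarrow> real \<Rightarrow> real \<Rightarrow> 'a \<times> 'a \<times> real) \<Rightarrow> bool" where
  "S_decoupled \<Omega> F \<longleftrightarrow>
     (\<forall>(X, P, t)\<in>\<Omega>. \<forall>S S'. X_rhs F X P S t = X_rhs F X P S' t \<and> P_rhs F X P S t = P_rhs F X P S' t)"

text \<open>The curves \<open>X\<close>, \<open>P\<close>, \<open>S\<close> satisfy the first two of the three equations on the time set \<open>T\<close>.\<close>

definition satisfies_XP_equations ::
  "('a::real_normed_vector \<Rightarrow> 'a \<Rightarrow> real \<Rightarrow> real \<Rightarrow> 'a \<times> 'a \<times> real) \<Rightarrow> real set \<Rightarrow>
    (real \<Rightarrow> 'a) \<Rightarrow> (real \<Rightarrow> 'a) \<Rightarrow> (real \<Rightarrow> real) \<Rightarrow> bool" where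
  "satisfies_XP_equations F T X P S \<longleftrightarrow>
     (\<forall>t\<in>T. (X has_vector_derivative X_rhs F (X t) (P t) (S t) t) (at t) \<and>
            (P has_vector_derivative P_rhs F (X t) (P t) (S t) t) (at t))"

definition legendre_conj :: "('a::real_inner \<Rightarrow> real) \<Rightarrow> 'a \<Rightarrow> ereal" where
  "legendre_conj h P = (SUP V. ereal (inner P V - h V))"

definition legendre_conj_real :: "('a::real_inner \<Rightarrow> real) \<Rightarrow> 'a \<Rightarrow> real" where
  "legendre_conj_real h P = real_of_ereal (legendre_conj h P)"

definition bregman_div :: "('a::real_inner \<Rightarrow> real) \<Rightarrow> 'a \<Rightarrow> 'a \<Rightarrow> real" where
  "bregman_div g Y X = g Y - g X - inner (grad g X) (Y - X)"

definition bregman_H ::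
  "('a::real_inner \<Rightarrow> real) \<Rightarrow> ('a \<Rightarrow> real) \<Rightarrow> (real \<Rightarrow> real) \<Rightarrow> (real \<Rightarrow> real) \<Rightarrow> (real \<Rightarrow> real) \<Rightarrow>
    'a \<Rightarrow> 'a \<Rightarrow> real \<Rightarrow> real" where
  "bregman_H h f \<alpha> \<beta> \<gamma> X P t =
     exp (\<alpha> t + \<gamma> t) *
       (bregman_div (legendre_conj_real h) (exp (- \<gamma> t) *\<^sub>R P + grad h X) (grad h X)
        + exp (\<beta> t) * f X)"

text \<open>The formula for \<open>bregman_H\<close> makes sense at a point when every gradient and every value of the
  conjugate occurring in it exists. In particular the conjugate, which may be infinite, must be
  finite near \<open>grad h X\<close> and differentiable there.\<close>

definition bregman_H_defined ::
  "('a::real_inner \<Rightarrow> real) \<Rightarrow> (real \<Rightarrow> real) \<Rightarrow> 'a \<Rightarrow> 'a \<Rightarrow> real \<Rightarrow> bool" where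
  "bregman_H_defined h \<gamma> X P t \<longleftrightarrow>
     h differentiable (at X) \<and>
     (\<forall>\<^sub>F Q in nhds (grad h X). \<bar>legendre_conj h Q\<bar> \<noteq> \<infinity>) \<and>
     legendre_conj_real h differentiable (at (grad h X)) \<and>
     \<bar>legendre_conj h (exp (- \<gamma> t) *\<^sub>R P + grad h X)\<bar> \<noteq> \<infinity>"

definition bregman_domain ::
  "('a::real_inner \<Rightarrow> real) \<Rightarrow> ('a \<Rightarrow> real) \<Rightarrow> (real \<Rightarrow> real) \<Rightarrow> (real \<Rightarrow> real) \<Rightarrow> (real \<Rightarrow> real) \<Rightarrow>
    real set \<Rightarrow> ('a \<times> 'a \<times> real) set" where
  "bregman_domain h f \<alpha> \<beta> \<gamma> T =
     {(X, P, t). t \<in> T \<and>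
        (\<forall>\<^sub>F (X', P') in nhds (X, P). bregman_H_defined h \<gamma> X' P' t) \<and>
        (\<lambda>(X', P'). bregman_H h f \<alpha> \<beta> \<gamma> X' P' t) differentiable (at (X, P))}"

definition bregman_dynamics ::
  "('a::real_inner \<Rightarrow> real) \<Rightarrow> ('a \<Rightarrow> real) \<Rightarrow> (real \<Rightarrow> real) \<Rightarrow> (real \<Rightarrow> real) \<Rightarrow> (real \<Rightarrow> real) \<Rightarrow>
    real set \<Rightarrow> (real \<Rightarrow> 'a) \<Rightarrow> (real \<Rightarrow> 'a) \<Rightarrow> bool" where
  "bregman_dynamics h f \<alpha> \<beta> \<gamma> T X P \<longleftrightarrow>
     (\<forall>t\<in>T. (X has_vector_derivative grad (\<lambda>P'. bregman_H h f \<alpha> \<beta> \<gamma> (X t) P' t) (P t)) (at t) \<and>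
            (P has_vector_derivative - grad (\<lambda>X'. bregman_H h f \<alpha> \<beta> \<gamma> X' (P t) t) (X t)) (at t))"

text \<open>The curve \<open>X\<close> is twice differentiable on \<open>T\<close>, with first and second derivatives \<open>V\<close> and \<open>A\<close>.\<close>

definition nesterov_ode :: "('a::real_inner \<Rightarrow> real) \<Rightarrow> real set \<Rightarrow> (real \<Rightarrow> 'a) \<Rightarrow> bool" where
  "nesterov_ode f T X \<longleftrightarrow>
     (\<exists>V A. \<forall>t\<in>T. (X has_vector_derivative V t) (at t) \<and> (V has_vector_derivative A t) (at t) \<and>
        A t + (3 / t) *\<^sub>R V t + grad f (X t) = 0)"

end

theory Submission
  imports Defs
begin

text \<open>Every claim is a computation of partial gradients of the contact Hamiltonian, followed
  by the observation that \<open>S\<close> has disappeared from the first two velocities.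
  \<open>S\<close> enters those velocities only through the gradients in \<open>X\<close> and
  \<open>P\<close> and through the derivative in \<open>S\<close>. If the Hamiltonian is affine in
  \<open>S\<close> with a slope depending at most on \<open>t\<close>, the \<open>S\<close> term is
  constant in \<open>X\<close> and \<open>P\<close> and leaves the gradients alone, while the
  derivative in \<open>S\<close> is just the slope. Slope 0 removes the damping and leaves
  Hamilton's equations (\<open>std1_no_S\<close>), with the Bregman Hamiltonian as an instance.
  Slopes \<open>c\<close> and \<open>3 / t\<close> give linear damping of the momentum
  (\<open>std1_affine_S\<close>, \<open>std1_nesterov\<close>). In the std2 system slope 2 damps
  both variables at unit rate (\<open>std2_descent\<close>). Nesterov's equation arises because the
  gradient of the kinetic energy is \<open>P\<close>: the momentum is the velocity, and the
  first-order system is the second-order equation in disguise (\<open>nesterov_ode_iff\<close>).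

  Since \<open>grad\<close> is a definite description, evaluating it takes uniqueness
  (\<open>gderiv_unique\<close>, from uniqueness of the Frechet derivative) and existence
  (\<open>gderiv_grad\<close>).\<close>

lemma gderiv_unique:
  assumes "GDERIV g x :> D" and "GDERIV g x :> E"
  shows "D = E"
proof -
  have "(\<lambda>h. inner h D) = (\<lambda>h. inner h E)"
    using assms unfolding gderiv_def by (rule has_derivative_unique)
  then have "inner h D = inner h E" for h
    by (rule fun_cong)
  then show ?thesis
    using vector_eq_ldot by blast
qed

lemma grad_eqI:
  assumes "GDERIV g x :> D"
  shows "grad g x = D"
  unfolding grad_def using assms by (rule the_equality) (rule gderiv_unique[OF _ assms])

text \<open>Riesz representation: the derivative is a linear functional on a finite-dimensional
  space, hence the inner product with a fixed vector, namely its adjoint applied to 1.\<close>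

lemma gderiv_grad:
  fixes g :: "'a::euclidean_space \<Rightarrow> real"
  assumes "g differentiable (at x)"
  shows "GDERIV g x :> grad g x"
proof -
  obtain g' where g': "(g has_derivative g') (at x)"
    using assms unfolding differentiable_def by blast
  have "g' = (\<lambda>h. inner h (adjoint g' 1))"
    using adjoint_works[OF has_derivative_linear[OF g'], of _ 1] by (simp add: fun_eq_iff)
  with g' have D: "GDERIV g x :> adjoint g' 1"
    unfolding gderiv_def by (rule back_subst)
  show ?thesis
    using D unfolding grad_eqI[OF D] .
qed

lemma gderiv_inner_left: "GDERIV (\<lambda>x. inner a x) x :> a"
  unfolding gderiv_def by (auto intro!: derivative_eq_intros simp: inner_commute)

lemma gderiv_half_norm_square: "GDERIV (\<lambda>x. 1/2 * (norm x)\<^sup>2) x :> x"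
  unfolding gderiv_def power2_norm_eq_inner
  by (auto intro!: derivative_eq_intros simp: inner_commute)

text \<open>Chain rule along the affine embedding of a slice. This and its mirror image turn joint
  differentiability of \<open>H\<close> into the slicewise differentiability that the gradient
  computations use.\<close>

lemma differentiable_partial_left:
  assumes "(\<lambda>(x, y). g x y) differentiable (at (a, b))"
  shows "(\<lambda>x. g x b) differentiable (at a)"
proof -
  have "(\<lambda>x. (x, b)) differentiable (at a)"
    unfolding differentiable_def
    by (rule exI) (rule has_derivative_Pair has_derivative_const has_derivative_ident)+
  from differentiable_chain_at[OF this assms] show ?thesis
    by (simp add: o_def)
qed

lemma differentiable_partial_right:
  assumes "(\<lambda>(x, y). g x y) differentiable (at (a, b))"
  shows "(\<lambda>y. g a y) differentiable (at b)"
proof -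
  have "(\<lambda>y. (a, y)) differentiable (at b)"
    unfolding differentiable_def
    by (rule exI) (rule has_derivative_Pair has_derivative_const has_derivative_ident)+
  from differentiable_chain_at[OF this assms] show ?thesis
    by (simp add: o_def)
qed

lemma deriv_affine: "deriv (\<lambda>s. a + c * s) (s::real) = c"
  by (rule DERIV_imp_deriv) (auto intro!: derivative_eq_intros)

text \<open>The derivative in \<open>S\<close> is that of a constant function, so the damping term
  vanishes.\<close>

lemma std1_no_S:
  "std1_system (\<lambda>X P S t. H X P t) X P S t =
     (grad (\<lambda>P'. H X P' t) P, - grad (\<lambda>X'. H X' P t) X,
      inner (grad (\<lambda>P'. H X P' t) P) P - H X P t)"
  by (simp add: std1_system_def Let_def)

text \<open>The slope is a function of time so that one computation covers both the constant
  \<open>c\<close> of the conformally symplectic case and the \<open>3 / t\<close> of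
  Nesterov's.\<close>

lemma std1_affine_S:
  fixes H :: "'a::euclidean_space \<Rightarrow> 'a \<Rightarrow> real"
  assumes "(\<lambda>X'. H X' P) differentiable (at X)" and "(\<lambda>P'. H X P') differentiable (at P)"
  shows "std1_system (\<lambda>X P S t. H X P + c t * S) X P S t =
     (grad (\<lambda>P'. H X P') P, - grad (\<lambda>X'. H X' P) X - c t *\<^sub>R P,
      inner (grad (\<lambda>P'. H X P') P) P - (H X P + c t * S))"
proof -
  have "grad (\<lambda>X'. H X' P + c t * S) X = grad (\<lambda>X'. H X' P) X"
    using GDERIV_add[OF gderiv_grad[OF assms(1)] GDERIV_const] by (intro grad_eqI) simp
  moreover have "grad (\<lambda>P'. H X P' + c t * S) P = grad (\<lambda>P'. H X P') P"
    using GDERIV_add[OF gderiv_grad[OF assms(2)] GDERIV_const] by (intro grad_eqI) simp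
  ultimately show ?thesis
    by (simp add: std1_system_def deriv_affine Let_def)
qed

text \<open>The coefficient 2 of \<open>S\<close> cancels the factors 1/2 in
  \<open>std2_system\<close>, which produces \<open>- X\<close> and \<open>- P\<close>. The linear
  terms shift the gradients by \<open>Xs\<close> in \<open>P\<close> and by \<open>- Ps\<close> in
  \<open>X\<close>; the minus sign before the gradient in \<open>X\<close> turns the latter into
  \<open>+ Ps\<close>.\<close>

lemma std2_descent:
  fixes H :: "'a::euclidean_space \<Rightarrow> 'a \<Rightarrow> real" and Xs Ps :: 'a
  assumes "(\<lambda>X'. H X' P) differentiable (at X)" and "(\<lambda>P'. H X P') differentiable (at P)"
  defines "F \<equiv> std2_system (\<lambda>X P S t. H X P + inner Xs P - inner Ps X + 2 * S)"
  shows "X_rhs F X P S t = grad (\<lambda>P'. H X P') P + Xs - X"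
    and "P_rhs F X P S t = - grad (\<lambda>X'. H X' P) X + Ps - P"
proof -
  \<comment> \<open>The gradient is written term by term, zeros included, to match the shape that
    the sum and difference rules produce.\<close>
  have "GDERIV (\<lambda>X'. H X' P + inner Xs P - inner Ps X' + 2 * S) X
      :> grad (\<lambda>X'. H X' P) X + 0 - Ps + 0"
    by (intro GDERIV_add GDERIV_diff GDERIV_const gderiv_inner_left gderiv_grad assms)
  then have "grad (\<lambda>X'. H X' P + inner Xs P - inner Ps X' + 2 * S) X
      = grad (\<lambda>X'. H X' P) X - Ps"
    using grad_eqI by fastforce
  moreover have "GDERIV (\<lambda>P'. H X P' + inner Xs P' - inner Ps X + 2 * S) P
      :> grad (\<lambda>P'. H X P') P + Xs - 0 + 0"
    by (intro GDERIV_add GDERIV_diff GDERIV_const gderiv_inner_left gderiv_grad assms)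
  then have "grad (\<lambda>P'. H X P' + inner Xs P' - inner Ps X + 2 * S) P
      = grad (\<lambda>P'. H X P') P + Xs"
    using grad_eqI by fastforce
  ultimately show "X_rhs F X P S t = grad (\<lambda>P'. H X P') P + Xs - X"
    and "P_rhs F X P S t = - grad (\<lambda>X'. H X' P) X + Ps - P"
    by (simp_all add: F_def X_rhs_def P_rhs_def std2_system_def deriv_affine Let_def)
qed

lemma std1_nesterov:
  fixes f :: "'a::euclidean_space \<Rightarrow> real"
  assumes "f differentiable (at X)"
  defines "F \<equiv> std1_system (\<lambda>X P S t. 1/2 * (norm P)\<^sup>2 + f X + 3 / t * S)"
  shows "X_rhs F X P S t = P"
    and "P_rhs F X P S t = - grad f X - (3 / t) *\<^sub>R P"
proof -
  have X: "GDERIV (\<lambda>X'. 1/2 * (norm P)\<^sup>2 + f X') X :> 0 + grad f X"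
    by (intro GDERIV_add GDERIV_const gderiv_grad assms)
  have P: "GDERIV (\<lambda>P'. 1/2 * (norm P')\<^sup>2 + f X) P :> P + 0"
    by (intro GDERIV_add GDERIV_const gderiv_half_norm_square)
  have diff: "(\<lambda>X'. 1/2 * (norm P)\<^sup>2 + f X') differentiable (at X)"
    "(\<lambda>P'. 1/2 * (norm P')\<^sup>2 + f X) differentiable (at P)"
    using X P unfolding gderiv_def differentiable_def by blast+
  have "F X P S t = (P, - grad f X - (3 / t) *\<^sub>R P,
      inner P P - (1/2 * (norm P)\<^sup>2 + f X + 3 / t * S))"
    unfolding F_def
    by (subst std1_affine_S[OF diff]) (simp only: grad_eqI[OF X] grad_eqI[OF P] add_0_left add_0_right)
  then show "X_rhs F X P S t = P" and "P_rhs F X P S t = - grad f X - (3 / t) *\<^sub>R P"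
    by (simp_all add: X_rhs_def P_rhs_def)
qed

text \<open>The first equation forces \<open>P\<close> to be the velocity of \<open>X\<close>;
  substituting this into the second gives the second-order equation. The curve \<open>S\<close> is
  an arbitrary fixed one, because neither velocity depends on it.\<close>

lemma nesterov_ode_iff:
  fixes f :: "'a::euclidean_space \<Rightarrow> real"
  assumes "f differentiable_on UNIV"
  defines "F \<equiv> std1_system (\<lambda>X P S t. 1/2 * (norm P)\<^sup>2 + f X + 3 / t * S)"
  shows "nesterov_ode f T X \<longleftrightarrow> (\<exists>P. satisfies_XP_equations F T X P S)"
proof -
  have f: "f differentiable (at x)" for x
    using assms(1) by (simp add: differentiable_on_def)
  have sat: "satisfies_XP_equations F T X P S \<longleftrightarrow> (\<forall>t\<in>T. (X has_vector_derivative P t) (at t) \<and>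
      (P has_vector_derivative - grad f (X t) - (3 / t) *\<^sub>R P t) (at t))" for P
    unfolding satisfies_XP_equations_def F_def std1_nesterov[OF f] ..
  show ?thesis
  proof
    assume "nesterov_ode f T X"
    then obtain V A where VA: "\<And>t. t \<in> T \<Longrightarrow> (X has_vector_derivative V t) (at t)"
      "\<And>t. t \<in> T \<Longrightarrow> (V has_vector_derivative A t) (at t)"
      "\<And>t. t \<in> T \<Longrightarrow> A t + (3 / t) *\<^sub>R V t + grad f (X t) = 0"
      unfolding nesterov_ode_def by blast
    have "A t = - grad f (X t) - (3 / t) *\<^sub>R V t" if "t \<in> T" for t
      using VA(3)[OF that] by (simp add: eq_diff_eq eq_neg_iff_add_eq_0)
    \<comment> \<open>The momentum is chosen to be the velocity \<open>V\<close>.\<close>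
    then show "\<exists>P. satisfies_XP_equations F T X P S"
      using VA(1,2) unfolding sat by (intro exI[of _ V]) simp
  next
    assume "\<exists>P. satisfies_XP_equations F T X P S"
    then obtain P where "satisfies_XP_equations F T X P S" ..
    \<comment> \<open>Conversely, \<open>P\<close> serves as the first derivative of
      \<open>X\<close> and the prescribed velocity of \<open>P\<close> as the second; their sum with
      the damping and gradient terms cancels identically.\<close>
    then show "nesterov_ode f T X"
      unfolding nesterov_ode_def sat
      by (intro exI[of _ P] exI[of _ "\<lambda>t. - grad f (X t) - (3 / t) *\<^sub>R P t"]) simp
  qed
qed

theorem proposition1:
  shows
    "(\<forall>(H :: real^'n \<Rightarrow> real^'n \<Rightarrow> real \<Rightarrow> real) \<Omega>.
        (\<forall>(X, P, t)\<in>\<Omega>. (\<lambda>(X', P'). H X' P' t) differentiable (at (X, P))) \<longrightarrow>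
        (let F = std1_system (\<lambda>X P S t. H X P t) in
          (\<forall>(X, P, t)\<in>\<Omega>. \<forall>S.
             X_rhs F X P S t = grad (\<lambda>P'. H X P' t) P \<and>
             P_rhs F X P S t = - grad (\<lambda>X'. H X' P t) X) \<and>
          S_decoupled \<Omega> F))
     \<and>
     (\<forall>(h :: real^'n \<Rightarrow> real) f \<alpha> \<beta> \<gamma> T.
        open T \<and> is_interval T \<and>
        convex_on UNIV h \<and> f differentiable_on UNIV \<and>
        \<alpha> C1_differentiable_on T \<and> \<beta> C1_differentiable_on T \<and> \<gamma> C1_differentiable_on T \<longrightarrow>
        (let F = std1_system (\<lambda>X P S t. bregman_H h f \<alpha> \<beta> \<gamma> X P t);
             \<Omega> = bregman_domain h f \<alpha> \<beta> \<gamma> T in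
          (\<forall>(X, P, t)\<in>\<Omega>. \<forall>S.
             X_rhs F X P S t = grad (\<lambda>P'. bregman_H h f \<alpha> \<beta> \<gamma> X P' t) P \<and>
             P_rhs F X P S t = - grad (\<lambda>X'. bregman_H h f \<alpha> \<beta> \<gamma> X' P t) X) \<and>
          (\<forall>I X P S. open I \<and> is_interval I \<and> (\<forall>t\<in>I. (X t, P t, t) \<in> \<Omega>) \<longrightarrow>
             (satisfies_XP_equations F I X P S \<longleftrightarrow> bregman_dynamics h f \<alpha> \<beta> \<gamma> I X P)) \<and>
          S_decoupled \<Omega> F))
     \<and>
     (\<forall>(H :: real^'n \<Rightarrow> real^'n \<Rightarrow> real) (c :: real).
        (\<lambda>(X, P). H X P) differentiable_on UNIV \<longrightarrow>
        (let F = std1_system (\<lambda>X P S t. H X P + c * S) in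
          (\<forall>X P S t.
             X_rhs F X P S t = grad (\<lambda>P'. H X P') P \<and>
             P_rhs F X P S t = - grad (\<lambda>X'. H X' P) X - c *\<^sub>R P) \<and>
          S_decoupled UNIV F))
     \<and>
     (\<forall>(H :: real^'n \<Rightarrow> real^'n \<Rightarrow> real) Xs Ps.
        (\<lambda>(X, P). H X P) differentiable_on UNIV \<and>
        is_arg_min (\<lambda>(X, P). H X P) (\<lambda>_. True) (Xs, Ps) \<longrightarrow>
        (let F = std2_system (\<lambda>X P S t. H X P + inner Xs P - inner Ps X + 2 * S) in
          (\<forall>X P S t.
             X_rhs F X P S t = grad (\<lambda>P'. H X P') P + Xs - X \<and>
             P_rhs F X P S t = - grad (\<lambda>X'. H X' P) X + Ps - P) \<and>
          S_decoupled UNIV F))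
     \<and>
     (\<forall>f :: real^'n \<Rightarrow> real.
        f differentiable_on UNIV \<longrightarrow>
        (let F = std1_system (\<lambda>X P S t. 1/2 * (norm P)\<^sup>2 + f X + 3 / t * S) in
          (\<forall>T X P S. open T \<and> is_interval T \<and> T \<subseteq> {0<..} \<and> satisfies_XP_equations F T X P S \<longrightarrow>
             nesterov_ode f T X) \<and>
          (\<forall>T X. open T \<and> is_interval T \<and> T \<subseteq> {0<..} \<and> nesterov_ode f T X \<longrightarrow>
             (\<exists>P. \<forall>S. satisfies_XP_equations F T X P S)) \<and>
          S_decoupled {(X, P, t). 0 < t} F))"
proof (intro conjI allI impI)
  fix H :: "real^'n \<Rightarrow> real^'n \<Rightarrow> real \<Rightarrow> real" and \<Omega>
  show "let F = std1_system (\<lambda>X P S t. H X P t) in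
      (\<forall>(X, P, t)\<in>\<Omega>. \<forall>S.
         X_rhs F X P S t = grad (\<lambda>P'. H X P' t) P \<and>
         P_rhs F X P S t = - grad (\<lambda>X'. H X' P t) X) \<and>
      S_decoupled \<Omega> F"
    by (auto simp: Let_def X_rhs_def P_rhs_def S_decoupled_def std1_no_S)
next
  fix h f :: "real^'n \<Rightarrow> real" and \<alpha> \<beta> \<gamma> T
  show "let F = std1_system (\<lambda>X P S t. bregman_H h f \<alpha> \<beta> \<gamma> X P t);
           \<Omega> = bregman_domain h f \<alpha> \<beta> \<gamma> T in
        (\<forall>(X, P, t)\<in>\<Omega>. \<forall>S.
           X_rhs F X P S t = grad (\<lambda>P'. bregman_H h f \<alpha> \<beta> \<gamma> X P' t) P \<and>
           P_rhs F X P S t = - grad (\<lambda>X'. bregman_H h f \<alpha> \<beta> \<gamma> X' P t) X) \<and>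
        (\<forall>I X P S. open I \<and> is_interval I \<and> (\<forall>t\<in>I. (X t, P t, t) \<in> \<Omega>) \<longrightarrow>
           (satisfies_XP_equations F I X P S \<longleftrightarrow> bregman_dynamics h f \<alpha> \<beta> \<gamma> I X P)) \<and>
        S_decoupled \<Omega> F"
    \<comment> \<open>After rewriting with \<open>std1_no_S\<close>, the contact equations for
      \<open>X\<close> and \<open>P\<close> and the Bregman dynamics are literally the same
      formula.\<close>
    by (auto simp: Let_def X_rhs_def P_rhs_def S_decoupled_def std1_no_S satisfies_XP_equations_def
        bregman_dynamics_def)
next
  fix H :: "real^'n \<Rightarrow> real^'n \<Rightarrow> real" and c :: real
  assume "(\<lambda>(X, P). H X P) differentiable_on UNIV"
  then have "(\<lambda>(X, P). H X P) differentiable (at (X, P))" for X P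
    by (simp add: differentiable_on_def)
  note partials = differentiable_partial_left[OF this] differentiable_partial_right[OF this]
  show "let F = std1_system (\<lambda>X P S t. H X P + c * S) in
      (\<forall>X P S t.
         X_rhs F X P S t = grad (\<lambda>P'. H X P') P \<and>
         P_rhs F X P S t = - grad (\<lambda>X'. H X' P) X - c *\<^sub>R P) \<and>
      S_decoupled UNIV F"
    \<comment> \<open>The constant coefficient is the constant function of time; the instantiation
      is given explicitly so that the rewrite rule matches.\<close>
    by (simp add: Let_def X_rhs_def P_rhs_def S_decoupled_def std1_affine_S[where c = "\<lambda>_. c"] partials)
next
  fix H :: "real^'n \<Rightarrow> real^'n \<Rightarrow> real" and Xs Ps
  assume "(\<lambda>(X, P). H X P) differentiable_on UNIV \<and>
    is_arg_min (\<lambda>(X, P). H X P) (\<lambda>_. True) (Xs, Ps)"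
  then have "(\<lambda>(X, P). H X P) differentiable (at (X, P))" for X P
    by (simp add: differentiable_on_def)
  note partials = differentiable_partial_left[OF this] differentiable_partial_right[OF this]
  show "let F = std2_system (\<lambda>X P S t. H X P + inner Xs P - inner Ps X + 2 * S) in
      (\<forall>X P S t.
         X_rhs F X P S t = grad (\<lambda>P'. H X P') P + Xs - X \<and>
         P_rhs F X P S t = - grad (\<lambda>X'. H X' P) X + Ps - P) \<and>
      S_decoupled UNIV F"
    by (simp add: Let_def S_decoupled_def std2_descent partials)
next
  fix f :: "real^'n \<Rightarrow> real"
  assume f: "f differentiable_on UNIV"
  then have f': "f differentiable (at x)" for x
    by (simp add: differentiable_on_def)
  define F where "F = std1_system (\<lambda>X P S t. 1/2 * (norm P)\<^sup>2 + f X + 3 / t * S)"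
  note rhs = std1_nesterov[OF f', folded F_def]
  \<comment> \<open>\<open>nesterov_ode_iff\<close> yields a momentum curve for one given
    \<open>S\<close>, whereas the goal asks for a single \<open>P\<close> that works for all
    \<open>S\<close>. Independence of \<open>S\<close> bridges the two.\<close>
  have "satisfies_XP_equations F T X P S \<longleftrightarrow> satisfies_XP_equations F T X P S'" for T X P S S'
    by (simp add: satisfies_XP_equations_def rhs)
  moreover have "nesterov_ode f T X \<longleftrightarrow> (\<exists>P. satisfies_XP_equations F T X P S)" for T X S
    unfolding F_def by (rule nesterov_ode_iff[OF f])
  moreover have "S_decoupled {(X, P, t). 0 < t} F"
    by (simp add: S_decoupled_def rhs)
  ultimately show "let F = std1_system (\<lambda>X P S t. 1/2 * (norm P)\<^sup>2 + f X + 3 / t * S) in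
      (\<forall>T X P S. open T \<and> is_interval T \<and> T \<subseteq> {0<..} \<and> satisfies_XP_equations F T X P S \<longrightarrow>
         nesterov_ode f T X) \<and>
      (\<forall>T X. open T \<and> is_interval T \<and> T \<subseteq> {0<..} \<and> nesterov_ode f T X \<longrightarrow>
         (\<exists>P. \<forall>S. satisfies_XP_equations F T X P S)) \<and>
      S_decoupled {(X, P, t). 0 < t} F"
    unfolding Let_def F_def[symmetric] by blast
qed

end
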